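(* Let $(\Omega^\bullet,d)$ be a differential calculus on an algebra $A$, and let $V$ be a vector space of derivations on $A$, closed under commutator, for which the interior products and Lie derivatives are well defined. For all $\theta\in V$, all $n\ge 0$ and all $\omega\in\Omega^n$, $$d(\theta\lrcorner\,\omega)+\theta\lrcorner(d\omega)={\cal L}_\theta(\omega).$$
   Context: $A$ is an associative unital (not necessarily commutative) algebra over a field. A differential calculus on $A$ is a collection of $A$-bimodules $\Omega^n$, $n\ge 0$, with $\Omega^0=A$, with an associative graded product $\Omega^n\times\Omega^m\to\Omega^{n+m}$ extending the bimodule structure, and with a linear signed derivation $d:\Omega^n\to\Omega^{n+1}$, i.e. $d(\omega\tau)=d(\omega)\,\tau+(-1)^{|\omega|}\omega\,d(\tau)$ (where $|\omega|=n$ if $\omega\in\Omega^n$), such that $d^2=0$ and $\Omega^{n+1}$ is spanned by the elements $\omega\,db$ with $\omega\in\Omega^n$, $b\in A$. Everything is purely algebraic (no topology). $V$ is a vector space of linear maps $\theta:A\to A$ with $\theta(ab)=\theta(a)b+a\theta(b)$, closed under the commutator $[\theta,\phi]=\theta\phi-\phi\theta$. Interior product: for $\theta\in V$, $\theta\lrcorner:\Omega^{n+1}\to\Omega^n$ is the linear map determined by $\theta\lrcorner a=0$ for $a\in\Omega^0=A$, $\theta\lrcorner da=\theta(a)$, and $\theta\lrcorner(\omega\tau)=(\theta\lrcorner\,\omega)\tau+(-1)^{|\omega|}\omega(\theta\lrcorner\tau)$. Lie derivative: for $\theta\in V$, ${\cal L}_\theta:\Omega^n\to\Omega^n$ is the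 linear map determined by ${\cal L}_\theta(a)=\theta(a)$ for $a\in\Omega^0=A$, ${\cal L}_\theta(da)=d(\theta(a))$, and ${\cal L}_\theta(\omega\tau)={\cal L}_\theta(\omega)\tau+\omega{\cal L}_\theta(\tau)$. Standing assumption: for every $\theta\in V$ the maps $\theta\lrcorner$ and ${\cal L}_\theta$ are well defined on all of $\Omega^\bullet$ (i.e. compatible with all relations in the calculus). *)

theory Defs
  imports Complex_Main
begin

text \<open>
  The class \<open>ring\<close> together with an explicit unit is used instead of \<open>ring_1\<close>, which would
  exclude the zero algebra.
\<close>

locale unital_algebra = vector_space scale
  for scale :: "'k::field \<Rightarrow> 'a::ring \<Rightarrow> 'a" +
  fixes unit :: 'a
  assumes scale_mult_left: "scale c x * y = scale c (x * y)"
    and scale_mult_right: "x * scale c y = scale c (x * y)"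
    and unit_left: "unit * x = x"
    and unit_right: "x * unit = x"

text \<open>
  The family \<open>(\<Omega>\<^sup>n)\<close> is presented through its direct sum, the graded algebra on the type
  \<open>'w\<close>, with \<open>Omega n\<close> the homogeneous component of degree \<open>n\<close>. The map \<open>iota\<close> is the
  identification of \<open>A\<close> (the type \<open>'a\<close>) with the component of degree \<open>0\<close>; the bimodule
  actions are \<open>a \<cdot> \<omega> = iota a * \<omega>\<close> and \<open>\<omega> \<cdot> a = \<omega> * iota a\<close>. Families of linear maps
  \<open>\<Omega>\<^sup>n \<rightarrow> \<Omega>\<^sup>m\<close>, such as the differential, are linear maps on \<open>'w\<close> respecting the grading
  in the appropriate way.
\<close>

locale differential_calculus =
  A: unital_algebra scale_A unit_A + W: unital_algebra scale_W "iota unit_A"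
  for scale_A :: "'k::field \<Rightarrow> 'a::ring \<Rightarrow> 'a" and unit_A :: 'a
    and scale_W :: "'k \<Rightarrow> 'w::ring \<Rightarrow> 'w" and iota :: "'a \<Rightarrow> 'w" +
  fixes Omega :: "nat \<Rightarrow> 'w set" and d :: "'w \<Rightarrow> 'w"
  assumes iota_linear: "Vector_Spaces.linear scale_A scale_W iota"
    and iota_mult: "iota (a * b) = iota a * iota b"
    and iota_bij: "bij_betw iota UNIV (Omega 0)"
    and Omega_subspace: "W.subspace (Omega n)"
    and Omega_span: "W.span (\<Union>n. Omega n) = UNIV"
    and Omega_independent:
      "finite N \<Longrightarrow> (\<And>n. n \<in> N \<Longrightarrow> f n \<in> Omega n) \<Longrightarrow> (\<Sum>n\<in>N. f n) = 0 \<Longrightarrow> n \<in> N \<Longrightarrow> f n = 0"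
    and Omega_mult: "\<omega> \<in> Omega n \<Longrightarrow> \<tau> \<in> Omega m \<Longrightarrow> \<omega> * \<tau> \<in> Omega (n + m)"
    and d_linear: "Vector_Spaces.linear scale_W scale_W d"
    and d_degree: "\<omega> \<in> Omega n \<Longrightarrow> d \<omega> \<in> Omega (Suc n)"
    and d_leibniz: "\<omega> \<in> Omega n \<Longrightarrow> \<tau> \<in> Omega m \<Longrightarrow>
      d (\<omega> * \<tau>) = d \<omega> * \<tau> + scale_W ((-1) ^ n) (\<omega> * d \<tau>)"
    and d_squared: "\<omega> \<in> Omega n \<Longrightarrow> d (d \<omega>) = 0"
    and Omega_Suc: "Omega (Suc n) = W.span {\<omega> * d (iota b) | \<omega> b. \<omega> \<in> Omega n}"
begin

definition is_interior_product :: "('a \<Rightarrow> 'a) \<Rightarrow> ('w \<Rightarrow> 'w) \<Rightarrow> bool" where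
  "is_interior_product \<theta> i \<longleftrightarrow>
     Vector_Spaces.linear scale_W scale_W i \<and>
     (\<forall>n. \<forall>\<omega>\<in>Omega (Suc n). i \<omega> \<in> Omega n) \<and>
     (\<forall>a. i (iota a) = 0) \<and>
     (\<forall>a. i (d (iota a)) = iota (\<theta> a)) \<and>
     (\<forall>n m. \<forall>\<omega>\<in>Omega n. \<forall>\<tau>\<in>Omega m.
        i (\<omega> * \<tau>) = i \<omega> * \<tau> + scale_W ((-1) ^ n) (\<omega> * i \<tau>))"

definition is_lie_derivative :: "('a \<Rightarrow> 'a) \<Rightarrow> ('w \<Rightarrow> 'w) \<Rightarrow> bool" where
  "is_lie_derivative \<theta> L \<longleftrightarrow>
     Vector_Spaces.linear scale_W scale_W L \<and>
     (\<forall>n. \<forall>\<omega>\<in>Omega n. L \<omega> \<in> Omega n) \<and>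
     (\<forall>a. L (iota a) = iota (\<theta> a)) \<and>
     (\<forall>a. L (d (iota a)) = d (iota (\<theta> a))) \<and>
     (\<forall>n m. \<forall>\<omega>\<in>Omega n. \<forall>\<tau>\<in>Omega m. L (\<omega> * \<tau>) = L \<omega> * \<tau> + \<omega> * L \<tau>)"

text \<open>
  The defining conditions admit at most one solution, since the graded algebra is generated by
  \<open>a\<close> and \<open>da\<close> for \<open>a\<close> in \<open>A\<close>; being well defined is therefore the existence of a solution.
\<close>

definition interior_product :: "('a \<Rightarrow> 'a) \<Rightarrow> 'w \<Rightarrow> 'w" where
  "interior_product \<theta> = (THE i. is_interior_product \<theta> i)"

definition lie_derivative :: "('a \<Rightarrow> 'a) \<Rightarrow> 'w \<Rightarrow> 'w" where
  "lie_derivative \<theta> = (THE L. is_lie_derivative \<theta> L)"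

definition interior_product_well_defined :: "('a \<Rightarrow> 'a) \<Rightarrow> bool" where
  "interior_product_well_defined \<theta> \<longleftrightarrow> (\<exists>i. is_interior_product \<theta> i)"

definition lie_derivative_well_defined :: "('a \<Rightarrow> 'a) \<Rightarrow> bool" where
  "lie_derivative_well_defined \<theta> \<longleftrightarrow> (\<exists>L. is_lie_derivative \<theta> L)"

end

locale derivation_space =
  fixes scale :: "'k::field \<Rightarrow> 'a::ring \<Rightarrow> 'a" and V :: "('a \<Rightarrow> 'a) set"
  assumes linear: "\<theta> \<in> V \<Longrightarrow> Vector_Spaces.linear scale scale \<theta>"
    and leibniz: "\<theta> \<in> V \<Longrightarrow> \<theta> (a * b) = \<theta> a * b + a * \<theta> b"
    and zero_closed: "(\<lambda>a. 0) \<in> V"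
    and add_closed: "\<theta> \<in> V \<Longrightarrow> \<phi> \<in> V \<Longrightarrow> (\<lambda>a. \<theta> a + \<phi> a) \<in> V"
    and scale_closed: "\<theta> \<in> V \<Longrightarrow> (\<lambda>a. scale c (\<theta> a)) \<in> V"
    and commutator_closed: "\<theta> \<in> V \<Longrightarrow> \<phi> \<in> V \<Longrightarrow> (\<lambda>a. \<theta> (\<phi> a) - \<phi> (\<theta> a)) \<in> V"

end

theory Submission
  imports Defs
begin

text \<open>
  A linear map on the graded algebra is determined by its values on \<open>A\<close> and by how its value
  on \<open>\<omega> db\<close> arises from its value on \<open>\<omega>\<close>. For both sides of the formula the recursion is
  multiplication by \<open>db\<close> on the right plus \<open>\<omega> d(\<theta>(b))\<close>: in the anticommutator of the two
  signed derivations the mixed terms \<open>(d\<omega>) \<theta>(b)\<close> cancel, and \<open>d\<^sup>2 = 0\<close> removes the others.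
\<close>

context differential_calculus
begin

text \<open>The agreement set is a subspace, so induction on the degree through
  \<open>Omega_Suc\<close> puts every component in it, and \<open>Omega_span\<close> does the rest.
  The hypothesis \<open>step\<close> concerns only products with some \<open>d (iota b)\<close>, so
  it can be checked for an anticommutator without first proving a product rule for it.\<close>

lemma linear_eqI:
  assumes f: "Vector_Spaces.linear scale_W scale_W f"
    and g: "Vector_Spaces.linear scale_W scale_W g"
    and base: "\<And>a. f (iota a) = g (iota a)"
    and step: "\<And>n \<omega> b. \<omega> \<in> Omega n \<Longrightarrow> f \<omega> = g \<omega> \<Longrightarrow>
      f (\<omega> * d (iota b)) = g (\<omega> * d (iota b))"
  shows "f = g"
proof -
  \<comment> \<open>Agreement at 0 comes from homogeneity: both maps send \<open>scale_W 0 x\<close>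
    to 0.\<close>
  have eq_subspace: "W.subspace {x. f x = g x}"
    using f g unfolding Vector_Spaces.linear_iff
    by (auto intro!: W.subspaceI) (metis W.scale_zero_left)
  have degree: "Omega n \<subseteq> {x. f x = g x}" for n
  proof (induction n)
    case 0
    have "Omega 0 = range iota" using iota_bij by (auto simp: bij_betw_def)
    then show ?case using base by auto
  next
    case (Suc n)
    show ?case
      unfolding Omega_Suc
      by (rule W.span_minimal[OF _ eq_subspace]) (use Suc step in blast)
  qed
  have "W.span (\<Union>n. Omega n) \<subseteq> {x. f x = g x}"
    by (rule W.span_minimal[OF _ eq_subspace]) (use degree in blast)
  then show ?thesis by (auto simp: Omega_span)
qed

lemma iota_in_Omega: "iota a \<in> Omega 0"
  using iota_bij by (auto simp: bij_betw_def)

lemma d_iota_in_Omega: "d (iota a) \<in> Omega (Suc 0)"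
  by (rule d_degree[OF iota_in_Omega])

lemma is_interior_product_mult_d:
  assumes "is_interior_product \<theta> i" "\<omega> \<in> Omega n"
  shows "i (\<omega> * d (iota b)) = i \<omega> * d (iota b) + scale_W ((-1) ^ n) (\<omega> * iota (\<theta> b))"
proof -
  have "i (\<omega> * d (iota b)) = i \<omega> * d (iota b) + scale_W ((-1) ^ n) (\<omega> * i (d (iota b)))"
    using assms d_iota_in_Omega unfolding is_interior_product_def by blast
  then show ?thesis
    using assms(1) by (simp add: is_interior_product_def)
qed

lemma is_lie_derivative_mult_d:
  assumes "is_lie_derivative \<theta> L" "\<omega> \<in> Omega n"
  shows "L (\<omega> * d (iota b)) = L \<omega> * d (iota b) + \<omega> * d (iota (\<theta> b))"
proof -
  have "L (\<omega> * d (iota b)) = L \<omega> * d (iota b) + \<omega> * L (d (iota b))"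
    using assms d_iota_in_Omega unfolding is_lie_derivative_def by blast
  then show ?thesis
    using assms(1) by (simp add: is_lie_derivative_def)
qed

text \<open>Makes the definite description in \<open>interior_product\<close> meaningful: the value
  on \<open>\<omega> * d (iota b)\<close> depends only on the value on \<omega> and on
  \<theta>.\<close>

lemma is_interior_product_unique:
  assumes "is_interior_product \<theta> i" "is_interior_product \<theta> j"
  shows "i = j"
proof (rule linear_eqI)
  fix n \<omega> b assume "\<omega> \<in> Omega n" "i \<omega> = j \<omega>"
  then show "i (\<omega> * d (iota b)) = j (\<omega> * d (iota b))"
    by (simp add: assms[THEN is_interior_product_mult_d])
qed (use assms in \<open>auto simp: is_interior_product_def\<close>)

lemma is_lie_derivative_unique:
  assumes "is_lie_derivative \<theta> L" "is_lie_derivative \<theta> M"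
  shows "L = M"
proof (rule linear_eqI)
  fix n \<omega> b assume "\<omega> \<in> Omega n" "L \<omega> = M \<omega>"
  then show "L (\<omega> * d (iota b)) = M (\<omega> * d (iota b))"
    by (simp add: assms[THEN is_lie_derivative_mult_d])
qed (use assms in \<open>auto simp: is_lie_derivative_def\<close>)

lemma is_interior_product_interior_product:
  assumes "interior_product_well_defined \<theta>"
  shows "is_interior_product \<theta> (interior_product \<theta>)"
  using assms is_interior_product_unique
  unfolding interior_product_well_defined_def interior_product_def
  by (metis theI)

lemma is_lie_derivative_lie_derivative:
  assumes "lie_derivative_well_defined \<theta>"
  shows "is_lie_derivative \<theta> (lie_derivative \<theta>)"
  using assms is_lie_derivative_unique
  unfolding lie_derivative_well_defined_def lie_derivative_def
  by (metis theI)

text \<open>Stated for any solutions \<open>i\<close> and \<open>L\<close> of the defining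
  conditions, so that the computation is free of definite descriptions.\<close>

lemma anticommutator_eq_lie_derivative:
  assumes i: "is_interior_product \<theta> i" and L: "is_lie_derivative \<theta> L"
  shows "(\<lambda>\<omega>. d (i \<omega>) + i (d \<omega>)) = L"
proof (rule linear_eqI)
  have i_linear: "Vector_Spaces.linear scale_W scale_W i"
    and i_degree: "\<And>n \<omega>. \<omega> \<in> Omega (Suc n) \<Longrightarrow> i \<omega> \<in> Omega n"
    and i_iota: "\<And>a. i (iota a) = 0"
    and i_d: "\<And>a. i (d (iota a)) = iota (\<theta> a)"
    using i by (auto simp: is_interior_product_def)
  show "Vector_Spaces.linear scale_W scale_W L"
    using L by (simp add: is_lie_derivative_def)
  show "Vector_Spaces.linear scale_W scale_W (\<lambda>\<omega>. d (i \<omega>) + i (d \<omega>))"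
    using d_linear i_linear by (auto simp: Vector_Spaces.linear_iff W.scale_right_distrib)
  have d_add: "d (x + y) = d x + d y" and d_scale: "d (scale_W c x) = scale_W c (d x)"
    for x y c
    using d_linear by (auto simp: Vector_Spaces.linear_iff)
  have d_0: "d 0 = 0"
    using d_add[of 0 0] by auto
  show "d (i (iota a)) + i (d (iota a)) = L (iota a)" for a
    using L by (simp add: is_lie_derivative_def i_iota i_d d_0)
  fix n \<omega> b
  assume \<omega>: "\<omega> \<in> Omega n" and IH: "d (i \<omega>) + i (d \<omega>) = L \<omega>"
  let ?s = "(-1 :: 'k) ^ n" and ?b = "d (iota b)" and ?\<theta>b = "iota (\<theta> b)"
  have dd: "d ?b = 0" by (rule d_squared[OF iota_in_Omega])
  \<comment> \<open>The Leibniz rule needs the degree of \<open>i \<omega>\<close>, which is one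
    less than \<open>n\<close>. For \<open>n = 0\<close> there is no such degree, but then
    \<open>i \<omega> = 0\<close>; otherwise the second Leibniz term contains
    \<open>d ?b = 0\<close>.\<close>
  have d_i_mult: "d (i \<omega> * ?b) = d (i \<omega>) * ?b"
  proof (cases n)
    case 0
    then obtain a where "\<omega> = iota a" using \<omega> iota_bij by (auto simp: bij_betw_def)
    then show ?thesis by (simp add: i_iota d_0)
  next
    case (Suc m)
    then show ?thesis
      using d_leibniz[OF i_degree d_iota_in_Omega, of \<omega> m b] \<omega> dd by simp
  qed
  \<comment> \<open>One sign comes from moving \<open>i\<close> past \<omega>, the other from moving
    \<open>d\<close> past \<omega>; on the last term they multiply to 1.\<close>
  have "d (i (\<omega> * ?b)) = d (i \<omega>) * ?b + scale_W ?s (d \<omega> * ?\<theta>b) + scale_W (?s * ?s) (\<omega> * d ?\<theta>b)"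
    using d_leibniz[OF \<omega> iota_in_Omega, of "\<theta> b"]
    by (simp add: is_interior_product_mult_d[OF i \<omega>] d_add d_scale d_i_mult
        W.scale_right_distrib add.assoc)
  moreover have "?s * ?s = 1"
    by (simp flip: power_mult_distrib)
  \<comment> \<open>Since \<open>d ?b = 0\<close>, only \<open>d \<omega> * ?b\<close> is left
    inside \<open>i\<close>. Its left factor has degree \<open>Suc n\<close>, whence the minus sign
    that cancels the mixed term above.\<close>
  moreover have "i (d (\<omega> * ?b)) = i (d \<omega>) * ?b - scale_W ?s (d \<omega> * ?\<theta>b)"
    using d_leibniz[OF \<omega> d_iota_in_Omega, of b] is_interior_product_mult_d[OF i d_degree[OF \<omega>], of b]
    by (simp add: dd)
  ultimately have "d (i (\<omega> * ?b)) + i (d (\<omega> * ?b)) = (d (i \<omega>) + i (d \<omega>)) * ?b + \<omega> * d ?\<theta>b"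
    by (simp add: distrib_right)
  also have "\<dots> = L (\<omega> * ?b)"
    by (simp add: IH is_lie_derivative_mult_d[OF L \<omega>])
  finally show "d (i (\<omega> * ?b)) + i (d (\<omega> * ?b)) = L (\<omega> * ?b)" .
qed

end

theorem proposition2p5:
  fixes scale_A :: "'k::field \<Rightarrow> 'a::ring \<Rightarrow> 'a" and unit_A :: 'a
    and scale_W :: "'k \<Rightarrow> 'w::ring \<Rightarrow> 'w" and iota :: "'a \<Rightarrow> 'w"
    and Omega :: "nat \<Rightarrow> 'w set" and d :: "'w \<Rightarrow> 'w"
    and V :: "('a \<Rightarrow> 'a) set"
  assumes "differential_calculus scale_A unit_A scale_W iota Omega d"
    and "derivation_space scale_A V"
    and "\<And>\<theta>. \<theta> \<in> V \<Longrightarrow>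
      differential_calculus.interior_product_well_defined scale_W iota Omega d \<theta>"
    and "\<And>\<theta>. \<theta> \<in> V \<Longrightarrow>
      differential_calculus.lie_derivative_well_defined scale_W iota Omega d \<theta>"
  shows "\<forall>\<theta>\<in>V. \<forall>n. \<forall>\<omega>\<in>Omega n.
    d (differential_calculus.interior_product scale_W iota Omega d \<theta> \<omega>)
      + differential_calculus.interior_product scale_W iota Omega d \<theta> (d \<omega>)
      = differential_calculus.lie_derivative scale_W iota Omega d \<theta> \<omega>"
proof (intro ballI allI)
  interpret differential_calculus scale_A unit_A scale_W iota Omega d by fact
  fix \<theta> n \<omega> assume "\<theta> \<in> V"
  \<comment> \<open>The identity is proved between maps on the whole graded algebra and then
    evaluated at \<omega>.\<close>
  then have "(\<lambda>\<omega>. d (interior_product \<theta> \<omega>) + interior_product \<theta> (d \<omega>)) = lie_derivative \<theta>"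
    by (intro anticommutator_eq_lie_derivative[OF is_interior_product_interior_product
        is_lie_derivative_lie_derivative] assms(3,4))
  then show "d (interior_product \<theta> \<omega>) + interior_product \<theta> (d \<omega>) = lie_derivative \<theta> \<omega>"
    by (rule fun_cong)
qed

end
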